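(* In the setting below, the action of $G_M$ on $\mathbb H\times\mathbb C^n$ is free and properly discontinuous.
   Context: Let $n\ge 1$ and let $M=(m_{ij})\in SL(2n+1,\mathbb Z)$. Assume that $M$ has exactly one real eigenvalue $\alpha$, that $\alpha>0$, $\alpha\neq 1$, that $\alpha$ is a simple eigenvalue, and that the remaining eigenvalues are $\beta_1,\dots,\beta_k,\bar\beta_1,\dots,\bar\beta_k$ with $\mathrm{Im}\,\beta_j>0$. Let $W\subset\mathbb C^{2n+1}$ be the direct sum of the generalized eigenspaces of $M$ for $\beta_1,\dots,\beta_k$ (so $\dim_{\mathbb C}W=n$). Fix a real eigenvector $a=(a^{(1)},\dots,a^{(2n+1)})^\top\in\mathbb R^{2n+1}$ of $M$ for $\alpha$ and a basis $b_1,\dots,b_n$ of $W$, $b_j=(b_j^{(1)},\dots,b_j^{(2n+1)})^\top$, and let $R=(r_{\ell j})\in M_n(\mathbb C)$ be given by $Mb_j=\sum_{\ell=1}^n r_{\ell j}b_\ell$. For $i=1,\dots,2n+1$ put $u_i=(a^{(i)},b_1^{(i)},\dots,b_n^{(i)})^\top\in\mathbb R\times\mathbb C^n$. Let $\mathbb H=\{w\in\mathbb C:\mathrm{Im}\,w>0\}$, and define holomorphic automorphisms of $\mathbb H\times\mathbb C^n$ by $g_0(w,z)=(\alpha w,R^\top z)$ and $g_i(w,z)=(w,z)+u_i$ for $1\le i\le 2n+1$. Let $G_M$ be the group generated by $g_0,\dots,g_{2n+1}$. *)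

theory Defs
  imports "HOL-Analysis.Analysis" "HOL-Computational_Algebra.Polynomial"
    "HOL-Algebra.Bij" "HOL-Algebra.Generated_Groups"
begin

text \<open>Integer matrix viewed over the complex / real numbers.\<close>
definition cmat :: "int^'m^'m \<Rightarrow> complex^'m^'m" where
  "cmat M = (\<chi> i j. of_int (M $ i $ j))"

definition rmat :: "int^'m^'m \<Rightarrow> real^'m^'m" where
  "rmat M = (\<chi> i j. of_int (M $ i $ j))"

text \<open>(Complex) eigenvalues of a complex square matrix.\<close>
definition mat_eigenvalue :: "complex^'m^'m \<Rightarrow> complex \<Rightarrow> bool" where
  "mat_eigenvalue A l \<longleftrightarrow> (\<exists>v. v \<noteq> 0 \<and> A *v v = l *s v)"

text \<open>Characteristic polynomial det(x I - A).\<close>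
definition charpoly :: "complex^'m^'m \<Rightarrow> complex poly" where
  "charpoly A = det (\<chi> i j. (if i = j then [:0, 1:] else 0) - [:A $ i $ j:])"

text \<open>Generalized eigenspace ker (A - l I)^m, m the size of the matrix.\<close>
definition gen_eigenspace :: "complex^'m^'m \<Rightarrow> complex \<Rightarrow> (complex^'m) set" where
  "gen_eigenspace A l = {v. ((\<lambda>x. A *v x - l *s x) ^^ CARD('m)) v = 0}"

text \<open>Direct sum (= complex span of the union) of the generalized eigenspaces
  for the eigenvalues with positive imaginary part.\<close>
definition upper_space :: "complex^'m^'m \<Rightarrow> (complex^'m) set" where
  "upper_space A = vec.span (\<Union> {gen_eigenspace A \<beta> | \<beta>. mat_eigenvalue A \<beta> \<and> Im \<beta> > 0})"

text \<open>The domain H x C^n.\<close>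
definition HC :: "(complex \<times> (complex^'n)) set" where
  "HC = {(w, z). Im w > 0}"

text \<open>The generators g_0 and g_i (i indexes the coordinates of C^(2n+1)).\<close>
definition gen0 :: "real \<Rightarrow> complex^'n^'n \<Rightarrow> complex \<times> (complex^'n) \<Rightarrow> complex \<times> (complex^'n)" where
  "gen0 \<alpha> R = (\<lambda>(w, z). (complex_of_real \<alpha> * w, transpose R *v z))"

definition uvec :: "real^'m \<Rightarrow> ('n \<Rightarrow> complex^'m) \<Rightarrow> 'm \<Rightarrow> complex \<times> (complex^'n)" where
  "uvec a b i = (complex_of_real (a $ i), (\<chi> j. b j $ i))"

definition gentr :: "real^'m \<Rightarrow> ('n \<Rightarrow> complex^'m) \<Rightarrow> 'm \<Rightarrow> complex \<times> (complex^'n) \<Rightarrow> complex \<times> (complex^'n)" where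
  "gentr a b i = (\<lambda>p. p + uvec a b i)"

text \<open>The group G_M, as the subgroup of the group of bijections of H x C^n
  generated by g_0, g_1, ..., g_(2n+1).\<close>
definition GM :: "real \<Rightarrow> complex^'n^'n \<Rightarrow> real^'m \<Rightarrow> ('n \<Rightarrow> complex^'m)
    \<Rightarrow> (complex \<times> (complex^'n) \<Rightarrow> complex \<times> (complex^'n)) set" where
  "GM \<alpha> R a b = generate (BijGroup HC)
     (insert (restrict (gen0 \<alpha> R) HC) ((\<lambda>i. restrict (gentr a b i) HC) ` UNIV))"

text \<open>Free action: only the identity has a fixed point.\<close>
definition free_action :: "'a set \<Rightarrow> ('a \<Rightarrow> 'a) set \<Rightarrow> bool" where
  "free_action X G \<longleftrightarrow> (\<forall>g\<in>G. \<forall>p\<in>X. g p = p \<longrightarrow> g = (\<lambda>x\<in>X. x))"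

text \<open>Properly discontinuous action: for every compact K in X only finitely many
  group elements g satisfy gK \<inter> K \<noteq> {}.\<close>
definition properly_discontinuous :: "'a::topological_space set \<Rightarrow> ('a \<Rightarrow> 'a) set \<Rightarrow> bool" where
  "properly_discontinuous X G \<longleftrightarrow>
     (\<forall>K. compact K \<and> K \<subseteq> X \<longrightarrow> finite {g \<in> G. g ` K \<inter> K \<noteq> {}})"

end

theory Submission
  imports Defs
begin

text \<open>Every element of \<open>G\<^sub>M\<close> acts as \<open>p \<mapsto> D\<^sup>k p + v\<close>, where \<open>D = g\<^sub>0\<close>, \<open>k\<close> is an integer
  and \<open>v\<close> lies in the lattice \<open>\<Lambda>\<close> spanned over \<open>\<int>\<close> by the \<open>u\<^sub>i\<close>: \<open>\<Lambda>\<close> is \<open>D\<close>-stable since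
  \<open>D u\<^sub>i = \<Sum>\<^sub>k m\<^sub>i\<^sub>k u\<^sub>k\<close>, and \<open>D\<^sup>-\<^sup>1\<close>-stable since \<open>M\<close> is unimodular. As \<open>D\<^sup>k\<close> multiplies
  \<open>Im w\<close> by \<open>\<alpha>\<^sup>k\<close>, a fixed point forces \<open>k = 0\<close> and then \<open>v = 0\<close>. On a compact \<open>K\<close> the
  values of \<open>Im w\<close> lie in some \<open>[c, C]\<close> with \<open>c > 0\<close>, which leaves finitely many \<open>k\<close>, and for
  each of them \<open>v\<close> lies in the bounded set \<open>K - D\<^sup>k K\<close>, which meets \<open>\<Lambda>\<close> in finitely many points
  because the \<open>u\<^sub>i\<close> are linearly independent over \<open>\<real>\<close>. That independence holds because
  \<open>a\<close>, the \<open>b\<^sub>j\<close> and their conjugates form a complex basis: they lie in generalized eigenspaces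
  for eigenvalues on the real line, in the upper and in the lower half plane, respectively.\<close>

section \<open>Integer vectors\<close>

lemma det_map_of_int:
  fixes M :: "int^'m::finite^'m"
  shows "det ((\<chi> i j. of_int (M $ i $ j)) :: 'a::comm_ring_1^'m^'m) = of_int (det M)"
  by (simp add: det_def)

definition int_vecs :: "(real^'m) set" where
  "int_vecs = {x. \<forall>i. x $ i \<in> \<int>}"

lemma int_vecs_axis: "axis i 1 \<in> int_vecs"
  by (simp add: int_vecs_def axis_def)

lemma int_vecs_add: "x \<in> int_vecs \<Longrightarrow> y \<in> int_vecs \<Longrightarrow> x + y \<in> int_vecs"
  by (simp add: int_vecs_def)

lemma int_vecs_uminus: "x \<in> int_vecs \<Longrightarrow> - x \<in> int_vecs"
  by (simp add: int_vecs_def)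

lemma int_vecs_matrix_vector_mult:
  assumes "\<And>i j. A $ i $ j \<in> \<int>" "x \<in> int_vecs"
  shows "A *v x \<in> int_vecs"
  using assms by (auto simp: int_vecs_def matrix_vector_mult_def)

lemma unimodular_int_vecs_preimage:
  fixes A :: "real^'m::finite^'m"
  assumes "\<And>i j. A $ i $ j \<in> \<int>" "det A = 1" "y \<in> int_vecs"
  shows "\<exists>x\<in>int_vecs. A *v x = y"
proof -
  define x where "x = (\<chi> k. det (\<chi> i j. if j = k then y $ i else A $ i $ j))"
  have "A *v x = y" using cramer[of A] assms(2) by (simp add: x_def)
  moreover have "x \<in> int_vecs"
    using assms(1,3) unfolding int_vecs_def x_def det_def
    by (auto intro!: Ints_sum Ints_mult Ints_prod)
  ultimately show ?thesis by blast
qed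

lemma finite_int_vecs_Int_bounded:
  assumes "bounded S"
  shows "finite (int_vecs \<inter> S)"
proof -
  obtain r where r: "\<And>x. x \<in> S \<Longrightarrow> norm x \<le> r" using assms by (auto simp: bounded_iff)
  define N where "N = \<lceil>r\<rceil>"
  let ?T = "PiE (UNIV :: 'a set) (\<lambda>_. {-N..N})"
  have "int_vecs \<inter> S \<subseteq> (\<lambda>f. \<chi> i. of_int (f i)) ` ?T"
  proof
    fix x :: "real^'a" assume x: "x \<in> int_vecs \<inter> S"
    define f where "f i = \<lfloor>x $ i\<rfloor>" for i
    have xi: "of_int (f i) = x $ i" for i
      using x by (auto simp: int_vecs_def f_def elim!: Ints_cases)
    have "\<bar>of_int (f i)\<bar> \<le> r" for i
      using x r component_le_norm_cart[of x i] xi[of i] by force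
    then have "\<bar>f i\<bar> \<le> N" for i
      unfolding N_def by (metis le_of_int_ceiling of_int_abs of_int_le_iff order_trans)
    then have "f i \<in> {-N..N}" for i
      using abs_le_D1 abs_le_D2 minus_le_iff by (metis atLeastAtMost_iff)
    then have "f \<in> ?T" by auto
    moreover have "x = (\<chi> i. of_int (f i))" using xi by (simp add: vec_eq_iff)
    ultimately show "x \<in> (\<lambda>f. \<chi> i. of_int (f i)) ` ?T" by blast
  qed
  then show ?thesis by (rule finite_subset) (simp add: finite_PiE)
qed

lemma finite_linear_image_int_vecs_Int_bounded:
  fixes f :: "real^'m::finite \<Rightarrow> 'b::euclidean_space"
  assumes "linear f" "inj f" "bounded S"
  shows "finite (f ` int_vecs \<inter> S)"
proof -
  obtain B where B: "B > 0" "\<And>x. B * norm x \<le> norm (f x)"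
    using linear_inj_bounded_below_pos[OF assms(1,2)] by blast
  obtain r where r: "\<And>y. y \<in> S \<Longrightarrow> norm y \<le> r" using assms(3) by (auto simp: bounded_iff)
  have "f ` int_vecs \<inter> S \<subseteq> f ` (int_vecs \<inter> cball 0 (r / B))"
  proof
    fix y assume "y \<in> f ` int_vecs \<inter> S"
    then obtain x where x: "x \<in> int_vecs" "y = f x" "y \<in> S" by auto
    have "B * norm x \<le> r" using B(2)[of x] r x by force
    then have "norm x \<le> r / B" using B(1) by (simp add: field_simps)
    then show "y \<in> f ` (int_vecs \<inter> cball 0 (r / B))" using x by auto
  qed
  then show ?thesis
    by (rule finite_subset) (simp add: finite_int_vecs_Int_bounded)
qed

section \<open>Generalized eigenspaces\<close>

lemma independent_range_coeffs_eq_0: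
  fixes b :: "'n::finite \<Rightarrow> 'a::field^'m::finite"
  assumes "inj b" "vec.independent (range b)" "(\<Sum>j\<in>UNIV. c j *s b j) = 0"
  shows "c j = 0"
proof -
  define u where "u v = c (inv_into UNIV b v)" for v
  have "(\<Sum>v\<in>range b. u v *s v) = (\<Sum>j\<in>UNIV. c j *s b j)"
    using assms(1) by (simp add: sum.reindex u_def)
  then have "\<forall>v\<in>range b. u v = 0"
    using assms(2,3) vec.dependent_finite[of "range b"] by auto
  then show ?thesis using assms(1) by (auto simp: u_def)
qed

definition eig_shift :: "complex^'m^'m \<Rightarrow> complex \<Rightarrow> complex^'m \<Rightarrow> complex^'m" where
  "eig_shift A l = (\<lambda>x. A *v x - l *s x)"

definition gen_eigenspace_sum :: "complex^'m^'m \<Rightarrow> (complex \<Rightarrow> bool) \<Rightarrow> (complex^'m) set" where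
  "gen_eigenspace_sum A P = vec.span (\<Union> {gen_eigenspace A l | l. P l})"

lemma upper_space_eq_gen_eigenspace_sum:
  "upper_space A = gen_eigenspace_sum A (\<lambda>l. mat_eigenvalue A l \<and> 0 < Im l)"
  by (simp add: upper_space_def gen_eigenspace_sum_def)

context
  fixes A :: "complex^'m::finite^'m"
begin

lemma gen_eigenspace_eq_kernel: "gen_eigenspace A l = {v. (eig_shift A l ^^ CARD('m)) v = 0}"
  by (simp add: gen_eigenspace_def eig_shift_def)

lemma linear_eig_shift: "Vector_Spaces.linear (*s) (*s) (eig_shift A l)"
  unfolding eig_shift_def
  by (intro vec.linear_compose_sub matrix_vector_mul_linear_gen vec.linear_scale_self)

lemma linear_eig_shift_pow: "Vector_Spaces.linear (*s) (*s) (eig_shift A l ^^ k)"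
proof (induction k)
  case 0
  then show ?case using vec.linear_id by (simp add: id_def)
next
  case (Suc k)
  then show ?case unfolding funpow.simps(2) by (rule Vector_Spaces.linear_compose[OF _ linear_eig_shift])
qed

lemma eig_shift_commute: "eig_shift A l (eig_shift A m x) = eig_shift A m (eig_shift A l x)"
proof -
  have "A *v (c *s y) = c *s (A *v y)" for c y
    using vec.linear_scale[OF matrix_vector_mul_linear_gen] by blast
  then show ?thesis
    by (simp add: eig_shift_def algebra_simps)
qed

lemma subspace_gen_eigenspace: "vec.subspace (gen_eigenspace A l)"
  unfolding gen_eigenspace_eq_kernel by (rule vec.linear_subspace_kernel[OF linear_eig_shift_pow])

lemma eigenvector_in_gen_eigenspace:
  assumes "A *v v = l *s v"
  shows "v \<in> gen_eigenspace A l"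
proof -
  have "eig_shift A l v = 0" using assms by (simp add: eig_shift_def)
  moreover obtain k where "CARD('m) = Suc k" using not0_implies_Suc by fastforce
  ultimately show ?thesis
    using vec.linear_0[OF linear_eig_shift_pow] by (simp add: gen_eigenspace_eq_kernel funpow_swap1)
qed

lemma eig_shift_pow_in_gen_eigenspace:
  assumes "v \<in> gen_eigenspace A l"
  shows "(eig_shift A m ^^ k) v \<in> gen_eigenspace A l"
proof (induction k)
  case 0
  then show ?case using assms by simp
next
  case (Suc k)
  let ?w = "(eig_shift A m ^^ k) v"
  have "(eig_shift A l ^^ j) (eig_shift A m x) = eig_shift A m ((eig_shift A l ^^ j) x)" for j x
    by (induction j) (simp_all add: eig_shift_commute)
  then have "(eig_shift A l ^^ CARD('m)) (eig_shift A m ?w) = eig_shift A m 0"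
    using Suc.IH by (simp add: gen_eigenspace_eq_kernel)
  then show ?case
    using vec.linear_0[OF linear_eig_shift] by (simp add: gen_eigenspace_eq_kernel)
qed

text \<open>If \<open>A v = m v\<close> then \<open>(A - l)\<^sup>N v = (m - l)\<^sup>N v\<close>, which vanishes only if \<open>v = 0\<close> or \<open>m = l\<close>.\<close>

lemma eig_shift_eq_0_on_gen_eigenspace:
  assumes "v \<in> gen_eigenspace A l" "m \<noteq> l" "eig_shift A m v = 0"
  shows "v = 0"
proof -
  have shift_l: "eig_shift A l v = (m - l) *s v"
    using assms(3) by (simp add: eig_shift_def vec.scale_left_diff_distrib)
  have "(eig_shift A l ^^ k) v = ((m - l) ^ k) *s v" for k
  proof (induction k)
    case (Suc k)
    have "(eig_shift A l ^^ Suc k) v = (eig_shift A l ^^ k) ((m - l) *s v)"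
      by (simp add: funpow_swap1 shift_l)
    also have "\<dots> = (m - l) *s (eig_shift A l ^^ k) v"
      using vec.linear_scale[OF linear_eig_shift_pow] by blast
    finally show ?case using Suc by (simp add: mult.commute)
  qed simp
  then have "((m - l) ^ CARD('m)) *s v = 0" using assms(1) by (simp add: gen_eigenspace_eq_kernel)
  then show ?thesis using assms(2) by simp
qed

lemma eig_shift_pow_eq_0_on_gen_eigenspace:
  assumes "v \<in> gen_eigenspace A l" "m \<noteq> l" "(eig_shift A m ^^ k) v = 0"
  shows "v = 0"
  using assms
proof (induction k arbitrary: v)
  case (Suc k)
  have "(eig_shift A m ^^ k) (eig_shift A m v) = 0" using Suc.prems(3) by (simp add: funpow_swap1)
  then have "eig_shift A m v = 0"
    using Suc.IH Suc.prems(1,2) eig_shift_pow_in_gen_eigenspace[where k = 1] by simp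
  then show ?case using eig_shift_eq_0_on_gen_eigenspace Suc.prems by blast
qed simp

lemma gen_eigenspaces_independent:
  assumes "finite S" "\<forall>l\<in>S. v l \<in> gen_eigenspace A l" "(\<Sum>l\<in>S. v l) = 0"
  shows "\<forall>l\<in>S. v l = 0"
  using assms
proof (induction S arbitrary: v rule: finite_induct)
  case (insert m S)
  let ?P = "eig_shift A m ^^ CARD('m)"
  have "v m + (\<Sum>l\<in>S. v l) = 0" using insert.prems(2) insert.hyps by simp
  then have "?P (v m) + (\<Sum>l\<in>S. ?P (v l)) = 0"
    using vec.linear_add[OF linear_eig_shift_pow] vec.linear_sum[OF linear_eig_shift_pow]
      vec.linear_0[OF linear_eig_shift_pow] by metis
  moreover have "?P (v m) = 0" using insert.prems(1) by (simp add: gen_eigenspace_eq_kernel)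
  moreover have "\<forall>l\<in>S. ?P (v l) \<in> gen_eigenspace A l"
    using insert.prems(1) eig_shift_pow_in_gen_eigenspace by blast
  ultimately have "\<forall>l\<in>S. ?P (v l) = 0" using insert.IH[of "\<lambda>l. ?P (v l)"] by simp
  then have "\<forall>l\<in>S. v l = 0"
    using insert.prems(1) insert.hyps(2) eig_shift_pow_eq_0_on_gen_eigenspace by (metis insertCI)
  moreover have "v m = 0" using \<open>v m + (\<Sum>l\<in>S. v l) = 0\<close> calculation by simp
  ultimately show ?case by simp
qed simp

lemma gen_eigenspace_sum_decompose:
  assumes "w \<in> gen_eigenspace_sum A P"
  obtains S v where "finite S" "\<forall>l\<in>S. P l \<and> v l \<in> gen_eigenspace A l" "w = (\<Sum>l\<in>S. v l)"
proof -
  have "\<exists>S v. finite S \<and> (\<forall>l\<in>S. P l \<and> v l \<in> gen_eigenspace A l) \<and> w = (\<Sum>l\<in>S. v l)"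
    using assms unfolding gen_eigenspace_sum_def
  proof (induction rule: vec.span_induct_alt)
    case base
    then show ?case by (intro exI[of _ "{}"]) simp
  next
    case (step c x y)
    then obtain l0 where l0: "P l0" "x \<in> gen_eigenspace A l0" by blast
    from step obtain S v where S: "finite S" "\<forall>l\<in>S. P l \<and> v l \<in> gen_eigenspace A l" "y = (\<Sum>l\<in>S. v l)"
      by blast
    define v' where "v' = v(l0 := c *s x + (if l0 \<in> S then v l0 else 0))"
    have "(\<Sum>l\<in>S - {l0}. v' l) = (\<Sum>l\<in>S - {l0}. v l)"
      by (simp add: v'_def)
    then have "c *s x + y = (\<Sum>l\<in>insert l0 S. v' l)"
      using S(1,3) by (cases "l0 \<in> S") (simp_all add: v'_def sum.insert_remove sum.remove add.assoc)
    moreover have "\<forall>l\<in>insert l0 S. P l \<and> v' l \<in> gen_eigenspace A l"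
      using S(2) l0 subspace_gen_eigenspace
      by (auto simp: v'_def intro!: vec.subspace_add vec.subspace_scale vec.subspace_0)
    ultimately show ?case using S(1) by blast
  qed
  then show ?thesis using that by blast
qed

lemma gen_eigenspace_sum_disjoint:
  assumes "\<And>l. P l \<Longrightarrow> \<not> Q l" "x \<in> gen_eigenspace_sum A P" "y \<in> gen_eigenspace_sum A Q" "x + y = 0"
  shows "x = 0"
proof -
  obtain S1 v1 where S1: "finite S1" "\<forall>l\<in>S1. P l \<and> v1 l \<in> gen_eigenspace A l" "x = (\<Sum>l\<in>S1. v1 l)"
    using assms(2) by (rule gen_eigenspace_sum_decompose)
  obtain S2 v2 where S2: "finite S2" "\<forall>l\<in>S2. Q l \<and> v2 l \<in> gen_eigenspace A l" "y = (\<Sum>l\<in>S2. v2 l)"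
    using assms(3) by (rule gen_eigenspace_sum_decompose)
  define v where "v l = (if l \<in> S1 then v1 l else v2 l)" for l
  have disj: "S1 \<inter> S2 = {}" using S1(2) S2(2) assms(1) by blast
  have "(\<Sum>l\<in>S2. v l) = y"
    using S2(3) disj by (auto simp: v_def intro!: sum.cong)
  then have "(\<Sum>l\<in>S1 \<union> S2. v l) = x + y"
    using S1 S2(1) disj by (simp add: sum.union_disjoint v_def)
  then have "\<forall>l\<in>S1 \<union> S2. v l = 0"
    using S1 S2 assms(4) by (intro gen_eigenspaces_independent) (auto simp: v_def)
  then have "v1 l = 0" if "l \<in> S1" for l
    using that by (metis UnI1 v_def)
  then show ?thesis using S1(3) by simp
qed

lemma gen_eigenspace_sum_mono:
  "(\<And>l. P l \<Longrightarrow> Q l) \<Longrightarrow> gen_eigenspace_sum A P \<subseteq> gen_eigenspace_sum A Q"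
  unfolding gen_eigenspace_sum_def by (rule vec.span_mono) blast

lemma gen_eigenspace_subset_sum: "P l \<Longrightarrow> gen_eigenspace A l \<subseteq> gen_eigenspace_sum A P"
  unfolding gen_eigenspace_sum_def by (blast intro: vec.span_base)

end

section \<open>Complex conjugation and real vectors\<close>

definition vec_cnj :: "complex^'m \<Rightarrow> complex^'m" where
  "vec_cnj v = (\<chi> i. cnj (v $ i))"

lemma vec_cnj_vec_cnj [simp]: "vec_cnj (vec_cnj v) = v"
  by (simp add: vec_cnj_def vec_eq_iff)

lemma vec_cnj_add [simp]: "vec_cnj (x + y) = vec_cnj x + vec_cnj y"
  by (simp add: vec_cnj_def vec_eq_iff)

lemma vec_cnj_diff [simp]: "vec_cnj (x - y) = vec_cnj x - vec_cnj y"
  by (simp add: vec_cnj_def vec_eq_iff)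

lemma vec_cnj_scale [simp]: "vec_cnj (c *s x) = cnj c *s vec_cnj x"
  by (simp add: vec_cnj_def vec_eq_iff)

lemma vec_cnj_0 [simp]: "vec_cnj 0 = 0"
  by (simp add: vec_cnj_def vec_eq_iff)

lemma vec_cnj_eq_0_iff [simp]: "vec_cnj x = 0 \<longleftrightarrow> x = 0"
  by (metis vec_cnj_0 vec_cnj_vec_cnj)

lemma vec_cnj_sum: "vec_cnj (\<Sum>i\<in>I. f i) = (\<Sum>i\<in>I. vec_cnj (f i))"
  by (induction I rule: infinite_finite_induct) simp_all

lemma vec_cnj_in_span: "x \<in> vec.span S \<Longrightarrow> vec_cnj x \<in> vec.span (vec_cnj ` S)"
proof (induction rule: vec.span_induct_alt)
  case base
  then show ?case by (simp add: vec.span_zero)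
next
  case (step c x y)
  then show ?case by (simp add: vec.span_add vec.span_scale vec.span_base)
qed

lemma vec_cnj_cmat_mult: "vec_cnj (cmat M *v x) = cmat M *v vec_cnj x"
  unfolding vec_cnj_def vec_eq_iff matrix_vector_mult_def cmat_def by simp

lemma vec_cnj_gen_eigenspace:
  fixes M :: "int^'m::finite^'m"
  assumes "v \<in> gen_eigenspace (cmat M) l"
  shows "vec_cnj v \<in> gen_eigenspace (cmat M) (cnj l)"
proof -
  have "vec_cnj ((eig_shift (cmat M) l ^^ k) x) = (eig_shift (cmat M) (cnj l) ^^ k) (vec_cnj x)" for k x
    by (induction k) (simp_all add: eig_shift_def vec_cnj_cmat_mult)
  from this[of "CARD('m)" v] show ?thesis using assms by (simp add: gen_eigenspace_eq_kernel)
qed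

lemma vec_cnj_gen_eigenspace_sum:
  assumes "x \<in> gen_eigenspace_sum (cmat M) P"
  shows "vec_cnj x \<in> gen_eigenspace_sum (cmat M) (\<lambda>l. P (cnj l))"
proof -
  have "vec_cnj x \<in> vec.span (vec_cnj ` \<Union> {gen_eigenspace (cmat M) l | l. P l})"
    using assms unfolding gen_eigenspace_sum_def by (rule vec_cnj_in_span)
  also have "\<dots> \<subseteq> gen_eigenspace_sum (cmat M) (\<lambda>l. P (cnj l))"
    unfolding gen_eigenspace_sum_def
  proof (rule vec.span_mono, rule subsetI)
    fix y assume "y \<in> vec_cnj ` \<Union> {gen_eigenspace (cmat M) l | l. P l}"
    then obtain l x where "P l" "x \<in> gen_eigenspace (cmat M) l" "y = vec_cnj x" by blast
    then have "P (cnj (cnj l))" "y \<in> gen_eigenspace (cmat M) (cnj l)"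
      by (simp_all add: vec_cnj_gen_eigenspace)
    then show "y \<in> \<Union> {gen_eigenspace (cmat M) l | l. P (cnj l)}" by blast
  qed
  finally show ?thesis .
qed

definition vec_of_real :: "real^'m \<Rightarrow> complex^'m" where
  "vec_of_real x = (\<chi> i. of_real (x $ i))"

lemma cmat_mult_vec_of_real: "cmat M *v vec_of_real x = vec_of_real (rmat M *v x)"
  by (simp add: vec_eq_iff vec_of_real_def matrix_vector_mult_def cmat_def rmat_def)

lemma vec_of_real_eq_0_iff [simp]: "vec_of_real x = 0 \<longleftrightarrow> x = 0"
  by (simp add: vec_of_real_def vec_eq_iff)

definition real_pairing :: "real^'m \<Rightarrow> complex^'m \<Rightarrow> complex" where
  "real_pairing x v = (\<Sum>i\<in>UNIV. of_real (x $ i) * v $ i)"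

lemma real_pairing_add [simp]: "real_pairing x (u + v) = real_pairing x u + real_pairing x v"
  by (simp add: real_pairing_def sum.distrib distrib_left)

lemma real_pairing_scale [simp]: "real_pairing x (c *s v) = c * real_pairing x v"
  by (simp add: real_pairing_def sum_distrib_left algebra_simps)

lemma real_pairing_zero [simp]: "real_pairing x 0 = 0"
  by (simp add: real_pairing_def)

lemma real_pairing_sum [simp]: "real_pairing x (\<Sum>j\<in>J. f j) = (\<Sum>j\<in>J. real_pairing x (f j))"
  by (induction J rule: infinite_finite_induct) simp_all

lemma real_pairing_vec_cnj [simp]: "real_pairing x (vec_cnj v) = cnj (real_pairing x v)"
  by (simp add: real_pairing_def vec_cnj_def)

lemma real_pairing_vec_of_real: "real_pairing x (vec_of_real y) = of_real (\<Sum>i\<in>UNIV. x $ i * y $ i)"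
  by (simp add: real_pairing_def vec_of_real_def)

lemma real_pairing_axis: "real_pairing x (axis k 1) = of_real (x $ k)"
  by (simp add: real_pairing_def axis_def if_distrib cong: if_cong)

lemma real_pairing_transpose_rmat:
  "real_pairing (transpose (rmat M) *v x) v = real_pairing x (cmat M *v v)"
proof -
  have "real_pairing (transpose (rmat M) *v x) v
      = (\<Sum>i\<in>UNIV. \<Sum>k\<in>UNIV. of_real (x $ k) * (of_int (M $ k $ i) * v $ i))"
    by (simp add: real_pairing_def matrix_vector_mult_def transpose_def rmat_def sum_distrib_left
        sum_distrib_right mult_ac)
  also have "\<dots> = real_pairing x (cmat M *v v)"
    by (subst sum.swap) (simp add: real_pairing_def matrix_vector_mult_def cmat_def sum_distrib_left)
  finally show ?thesis .
qed

section \<open>The half space \<open>HC\<close> and its bijections\<close>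

lemma ln_powi:
  fixes x :: real
  assumes "0 < x"
  shows "ln (x powi k) = of_int k * ln x"
  using assms by (simp flip: powr_real_of_int'[of x k])

lemma powi_eq_1_iff:
  fixes \<alpha> :: real
  assumes "0 < \<alpha>" "\<alpha> \<noteq> 1"
  shows "\<alpha> powi k = 1 \<longleftrightarrow> k = 0"
proof
  assume "\<alpha> powi k = 1"
  then have "of_int k * ln \<alpha> = 0" using ln_powi[OF assms(1), of k] by simp
  then show "k = 0" using assms by simp
qed simp

lemma finite_powi_exponents_between:
  fixes \<alpha> c C :: real
  assumes "0 < c" "0 < \<alpha>" "\<alpha> \<noteq> 1"
  shows "finite {k::int. \<exists>s\<in>{c..C}. \<alpha> powi k * s \<in> {c..C}}"
proof -
  define N where "N = \<lceil>(ln C - ln c) / \<bar>ln \<alpha>\<bar>\<rceil>"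
  have "k \<in> {-N..N}" if "s \<in> {c..C}" "\<alpha> powi k * s \<in> {c..C}" for k s
  proof -
    have "ln (\<alpha> powi k * s) = of_int k * ln \<alpha> + ln s"
      using assms that by (simp add: ln_mult ln_powi)
    moreover have "ln c \<le> ln s" "ln s \<le> ln C" "ln c \<le> ln (\<alpha> powi k * s)" "ln (\<alpha> powi k * s) \<le> ln C"
      using assms that by auto
    ultimately have "\<bar>of_int k\<bar> * \<bar>ln \<alpha>\<bar> \<le> ln C - ln c"
      by (simp add: abs_mult[symmetric])
    moreover have "\<bar>ln \<alpha>\<bar> > 0" using assms by simp
    ultimately have "\<bar>of_int k\<bar> \<le> (ln C - ln c) / \<bar>ln \<alpha>\<bar>"
      by (simp add: field_simps)
    then show ?thesis unfolding N_def by (simp add: abs_le_iff) linarith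
  qed
  then have "{k. \<exists>s\<in>{c..C}. \<alpha> powi k * s \<in> {c..C}} \<subseteq> {-N..N}"
    by blast
  then show ?thesis by (rule finite_subset) simp
qed

lemma mem_HC_iff: "p \<in> HC \<longleftrightarrow> 0 < Im (fst p)"
  by (cases p) (simp add: HC_def)

lemma compact_subset_HC_Im_bounds:
  fixes K :: "(complex \<times> (complex^'n)) set"
  assumes "compact K" "K \<subseteq> HC"
  obtains c C where "0 < c" "\<forall>p\<in>K. Im (fst p) \<in> {c..C}"
proof (cases "K = {}")
  case True
  then show ?thesis using that[of 1] by simp
next
  case False
  let ?I = "(\<lambda>p. Im (fst p)) ` K"
  have "compact ?I" by (intro compact_continuous_image continuous_intros assms(1))
  then obtain c C where "c \<in> ?I" "C \<in> ?I" "\<forall>s\<in>?I. c \<le> s \<and> s \<le> C"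
    using compact_attains_inf[of ?I] compact_attains_sup[of ?I] False by (metis image_is_empty)
  moreover from this have "0 < c" using assms(2) by (auto simp: mem_HC_iff)
  ultimately show ?thesis using that[of c C] by auto
qed

lemma gen0_apply: "gen0 \<alpha> R p = (of_real \<alpha> * fst p, transpose R *v snd p)"
  by (cases p) (simp add: gen0_def)

lemma linear_matrix_vector_mult_complex: "linear (\<lambda>z::complex^'n. (A::complex^'n^'k) *v z)"
proof (rule linearI)
  show "A *v (r *\<^sub>R x) = r *\<^sub>R (A *v x)" for r x
    by (simp add: vec_eq_iff matrix_vector_mult_def scaleR_sum_right)
qed (simp add: matrix_vector_right_distrib)

lemma linear_gen0: "linear (gen0 \<alpha> R)"
proof (rule linearI)
  note lin = linear_matrix_vector_mult_complex[of "transpose R"]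
  show "gen0 \<alpha> R (p + q) = gen0 \<alpha> R p + gen0 \<alpha> R q" for p q
    using linear_add[OF lin] by (simp add: gen0_apply distrib_left)
  show "gen0 \<alpha> R (r *\<^sub>R p) = r *\<^sub>R gen0 \<alpha> R p" for r p
    using linear_scale[OF lin] by (simp add: gen0_apply scaleR_conv_of_real)
qed

lemma carrier_BijGroup: "carrier (BijGroup S) = Bij S"
  by (simp add: BijGroup_def)

lemma mult_BijGroup: "f \<in> Bij S \<Longrightarrow> g \<in> Bij S \<Longrightarrow> f \<otimes>\<^bsub>BijGroup S\<^esub> g = compose S f g"
  by (simp add: BijGroup_def)

lemma mult_BijGroup_UNIV: "f \<in> Bij UNIV \<Longrightarrow> g \<in> Bij UNIV \<Longrightarrow> f \<otimes>\<^bsub>BijGroup UNIV\<^esub> g = f \<circ> g"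
  by (simp add: mult_BijGroup compose_def restrict_UNIV o_def)

lemma one_BijGroup_UNIV: "\<one>\<^bsub>BijGroup UNIV\<^esub> = id"
  by (simp add: BijGroup_def restrict_UNIV id_def)

section \<open>Real independence of the \<open>u\<^sub>i\<close>\<close>

locale GM_data =
  fixes M :: "int^'m::finite^'m" and \<alpha> :: real and a :: "real^'m"
    and b :: "'n::finite \<Rightarrow> complex^'m" and R :: "complex^'n^'n"
  assumes dim: "CARD('m) = 2 * CARD('n) + 1"
    and SL: "det M = 1"
    and alpha_pos: "\<alpha> > 0" and alpha_ne1: "\<alpha> \<noteq> 1"
    and a_nz: "a \<noteq> 0" and a_eig: "rmat M *v a = \<alpha> *s a"
    and b_inj: "inj b" and b_indep: "vec.independent (range b)"
    and b_span: "vec.span (range b) = upper_space (cmat M)"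
    and R_def: "\<forall>j. cmat M *v b j = (\<Sum>l\<in>UNIV. R $ l $ j *s b l)"
begin

abbreviation upper :: "complex \<Rightarrow> bool" where
  "upper l \<equiv> mat_eigenvalue (cmat M) l \<and> 0 < Im l"

lemma b_coeffs_eq_0: "(\<Sum>j\<in>UNIV. c j *s b j) = 0 \<Longrightarrow> c j = 0"
  by (rule independent_range_coeffs_eq_0[OF b_inj b_indep])

lemma sum_b_in_upper: "(\<Sum>j\<in>UNIV. c j *s b j) \<in> gen_eigenspace_sum (cmat M) upper"
proof -
  have "(\<Sum>j\<in>UNIV. c j *s b j) \<in> vec.span (range b)"
    by (intro vec.span_sum vec.span_scale vec.span_base) auto
  then show ?thesis using b_span by (simp add: upper_space_eq_gen_eigenspace_sum)
qed

lemma a_in_gen_eigenspace: "vec_of_real a \<in> gen_eigenspace (cmat M) (of_real \<alpha>)"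
proof (rule eigenvector_in_gen_eigenspace)
  have "cmat M *v vec_of_real a = vec_of_real (\<alpha> *s a)"
    by (simp add: cmat_mult_vec_of_real a_eig)
  then show "cmat M *v vec_of_real a = of_real \<alpha> *s vec_of_real a"
    by (simp add: vec_eq_iff vec_of_real_def)
qed

text \<open>The three summands lie in sums of generalized eigenspaces for eigenvalues on the real line,
  in the upper and in the lower half plane; such sums are independent.\<close>

lemma basis_coeffs_eq_0:
  assumes "c *s vec_of_real a + (\<Sum>j\<in>UNIV. d j *s b j) + (\<Sum>j\<in>UNIV. e j *s vec_cnj (b j)) = 0"
  shows "c = 0 \<and> (\<forall>j. d j = 0) \<and> (\<forall>j. e j = 0)"
proof -
  let ?V = "gen_eigenspace_sum (cmat M)"
  define w where "w = (\<Sum>j\<in>UNIV. cnj (e j) *s b j)"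
  have cnj_w: "vec_cnj w = (\<Sum>j\<in>UNIV. e j *s vec_cnj (b j))"
    by (simp add: w_def vec_cnj_sum)
  have a_real: "c *s vec_of_real a \<in> ?V (\<lambda>l. Im l = 0)"
    using subsetD[OF gen_eigenspace_subset_sum a_in_gen_eigenspace, of "\<lambda>l. Im l = 0"]
    unfolding gen_eigenspace_sum_def by (simp add: vec.span_scale)
  have "vec_cnj w \<in> ?V (\<lambda>l. upper (cnj l))"
    unfolding w_def by (rule vec_cnj_gen_eigenspace_sum[OF sum_b_in_upper])
  moreover have "?V (\<lambda>l. upper (cnj l)) \<subseteq> ?V (\<lambda>l. Im l < 0)"
    by (rule gen_eigenspace_sum_mono) simp
  ultimately have w_lower: "vec_cnj w \<in> ?V (\<lambda>l. Im l < 0)" by blast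
  have "?V (\<lambda>l. Im l = 0) \<subseteq> ?V (\<lambda>l. Im l \<le> 0)" "?V (\<lambda>l. Im l < 0) \<subseteq> ?V (\<lambda>l. Im l \<le> 0)"
    by (rule gen_eigenspace_sum_mono; simp)+
  then have "c *s vec_of_real a \<in> ?V (\<lambda>l. Im l \<le> 0)" "vec_cnj w \<in> ?V (\<lambda>l. Im l \<le> 0)"
    using a_real w_lower by blast+
  then have nonpos: "c *s vec_of_real a + vec_cnj w \<in> ?V (\<lambda>l. Im l \<le> 0)"
    unfolding gen_eigenspace_sum_def by (rule vec.span_add)
  have "(\<Sum>j\<in>UNIV. d j *s b j) + (c *s vec_of_real a + vec_cnj w) = 0"
    using assms cnj_w by (simp add: add.commute add.left_commute)
  from gen_eigenspace_sum_disjoint[OF _ sum_b_in_upper nonpos this]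
  have d0: "(\<Sum>j\<in>UNIV. d j *s b j) = 0" by simp
  then have sum0: "c *s vec_of_real a + vec_cnj w = 0"
    using assms cnj_w by simp
  from gen_eigenspace_sum_disjoint[OF _ a_real w_lower this]
  have "c *s vec_of_real a = 0" by simp
  then have "c = 0" using a_nz by simp
  then have "w = 0" using sum0 by simp
  then have "\<forall>j. e j = 0" using b_coeffs_eq_0[of "\<lambda>j. cnj (e j)"] by (simp add: w_def)
  then show ?thesis using \<open>c = 0\<close> d0 b_coeffs_eq_0 by blast
qed

definition basis_comb :: "complex \<times> (complex^'n) \<times> (complex^'n) \<Rightarrow> complex^'m" where
  "basis_comb p = fst p *s vec_of_real a + (\<Sum>j\<in>UNIV. fst (snd p) $ j *s b j)
     + (\<Sum>j\<in>UNIV. snd (snd p) $ j *s vec_cnj (b j))"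

lemma linear_basis_comb: "linear basis_comb"
proof (rule linearI)
  show "basis_comb (p + q) = basis_comb p + basis_comb q" for p q
    by (simp add: basis_comb_def sum.distrib algebra_simps)
  have scaleR_scale: "(r *\<^sub>R c) *s v = r *\<^sub>R (c *s v)" for r and c :: complex and v :: "complex^'m"
    by (simp add: vec_eq_iff scaleR_conv_of_real[where 'a = complex])
  show "basis_comb (r *\<^sub>R p) = r *\<^sub>R basis_comb p" for r p
    by (simp add: basis_comb_def scaleR_scale scaleR_add_right scaleR_sum_right)
qed

text \<open>Counting real dimensions, \<open>2 + 4n = 2(2n + 1)\<close>, the injective real-linear map
  \<open>basis_comb\<close> is onto.\<close>

lemma surj_basis_comb: "surj basis_comb"
proof (rule linear_injective_imp_surjective[OF linear_basis_comb])
  show "inj basis_comb"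
  proof (rule linear_injective_0[OF linear_basis_comb, THEN iffD2], intro allI impI)
    fix p :: "complex \<times> (complex^'n) \<times> (complex^'n)"
    assume "basis_comb p = 0"
    then have "fst p = 0 \<and> (\<forall>j. fst (snd p) $ j = 0) \<and> (\<forall>j. snd (snd p) $ j = 0)"
      unfolding basis_comb_def by (rule basis_coeffs_eq_0)
    then show "p = 0" by (simp add: prod_eq_iff vec_eq_iff)
  qed
qed (simp add: dim)

definition uvec_comb :: "real^'m \<Rightarrow> complex \<times> (complex^'n)" where
  "uvec_comb x = (\<Sum>i\<in>UNIV. x $ i *\<^sub>R uvec a b i)"

lemma linear_uvec_comb: "linear uvec_comb"
  unfolding uvec_comb_def
  by (rule linearI) (simp_all add: sum.distrib scaleR_add_left scaleR_sum_right)

lemma uvec_comb_eq: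
  "uvec_comb x = (real_pairing x (vec_of_real a), \<chi> j. real_pairing x (b j))"
  by (simp add: uvec_comb_def uvec_def prod_eq_iff fst_sum snd_sum vec_eq_iff real_pairing_def
      vec_of_real_def scaleR_conv_of_real[where 'a = complex])

text \<open>A real relation \<open>x\<close> among the \<open>u\<^sub>i\<close> gives a complex linear form \<open>real_pairing x\<close>
  vanishing on \<open>a\<close> and the \<open>b\<^sub>j\<close>, hence on their conjugates, hence everywhere.\<close>

lemma inj_uvec_comb: "inj uvec_comb"
proof (rule linear_injective_0[OF linear_uvec_comb, THEN iffD2], intro allI impI)
  fix x assume "uvec_comb x = 0"
  then have a0: "real_pairing x (vec_of_real a) = 0" and b0: "\<And>j. real_pairing x (b j) = 0"
    by (simp_all add: uvec_comb_eq prod_eq_iff vec_eq_iff)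
  have "real_pairing x (basis_comb p) = 0" for p
    by (simp add: basis_comb_def a0 b0)
  then have "real_pairing x v = 0" for v
    using surj_basis_comb by (metis surjD)
  then have "x $ k = 0" for k
    using real_pairing_axis[of x k] by simp
  then show "x = 0" by (simp add: vec_eq_iff)
qed

section \<open>Powers of \<open>g\<^sub>0\<close> and the lattice\<close>

abbreviation D where "D \<equiv> gen0 \<alpha> R"

lemma cmat_mult_sum_b: "cmat M *v (\<Sum>j\<in>UNIV. x $ j *s b j) = (\<Sum>l\<in>UNIV. (R *v x) $ l *s b l)"
proof -
  have "cmat M *v (\<Sum>j\<in>UNIV. x $ j *s b j) = (\<Sum>j\<in>UNIV. \<Sum>l\<in>UNIV. (x $ j * R $ l $ j) *s b l)"
    using R_def
    by (simp add: vec.linear_sum[OF matrix_vector_mul_linear_gen]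
        vec.linear_scale[OF matrix_vector_mul_linear_gen] vec.scale_sum_right)
  also have "\<dots> = (\<Sum>l\<in>UNIV. (R *v x) $ l *s b l)"
    by (subst sum.swap) (simp add: matrix_vector_mult_def vec.scale_sum_left mult.commute)
  finally show ?thesis .
qed

lemma inj_R: "inj ((*v) R)"
proof -
  have "inj ((*v) (cmat M))"
    using det_nz_iff_inj_gen[of "(*v) (cmat M)"] det_map_of_int[of M, where 'a = complex] SL
    by (simp add: cmat_def)
  have "x = 0" if "R *v x = 0" for x
  proof -
    have "cmat M *v (\<Sum>j\<in>UNIV. x $ j *s b j) = cmat M *v 0"
      using cmat_mult_sum_b[of x] that by simp
    then have "(\<Sum>j\<in>UNIV. x $ j *s b j) = 0"
      by (rule injD[OF \<open>inj ((*v) (cmat M))\<close>])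
    then show "x = 0" using b_coeffs_eq_0[of "\<lambda>j. x $ j"] by (simp add: vec_eq_iff)
  qed
  then show ?thesis
    using vec.linear_inj_iff_eq_0[OF matrix_vector_mul_linear_gen] by blast
qed

lemma inj_D: "inj D"
proof -
  have "det R \<noteq> 0"
    using det_nz_iff_inj_gen[of "(*v) R"] inj_R by simp
  then have "inj ((*v) (transpose R))"
    using det_nz_iff_inj_gen[of "(*v) (transpose R)"] by simp
  then show ?thesis
    using alpha_pos by (auto simp: inj_def gen0_apply prod_eq_iff)
qed

lemma bij_D: "bij D"
  using linear_injective_imp_surjective[OF linear_gen0 inj_D] inj_D by (simp add: bij_def)

definition Dpow :: "int \<Rightarrow> complex \<times> (complex^'n) \<Rightarrow> complex \<times> (complex^'n)" where
  "Dpow k = D [^]\<^bsub>BijGroup UNIV\<^esub> k"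

lemma D_in_Bij: "D \<in> Bij UNIV"
  using bij_D by (simp add: Bij_def)

lemma Dpow_in_Bij: "Dpow k \<in> Bij UNIV"
  using group.int_pow_closed[OF group_BijGroup] D_in_Bij unfolding Dpow_def carrier_BijGroup .

lemma Dpow_add: "Dpow (k + l) = Dpow k \<circ> Dpow l"
proof -
  have "Dpow (k + l) = Dpow k \<otimes>\<^bsub>BijGroup UNIV\<^esub> Dpow l"
    unfolding Dpow_def
    by (rule group.int_pow_mult[OF group_BijGroup, unfolded carrier_BijGroup, OF D_in_Bij])
  then show ?thesis by (simp add: mult_BijGroup_UNIV Dpow_in_Bij)
qed

lemma Dpow_0: "Dpow 0 = id"
  by (simp add: Dpow_def one_BijGroup_UNIV)

lemma Dpow_1: "Dpow 1 = D"
  using group.int_pow_1[OF group_BijGroup] D_in_Bij unfolding Dpow_def carrier_BijGroup .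

lemma Dpow_succ: "Dpow (k + 1) = D \<circ> Dpow k"
  using Dpow_add[of 1 k] by (simp add: Dpow_1 add.commute)

lemma Dpow_pred: "Dpow (k - 1) = inv_into UNIV D \<circ> Dpow k"
proof -
  have "Dpow (-1) = inv\<^bsub>BijGroup UNIV\<^esub> Dpow 1"
    using group.int_pow_neg[OF group_BijGroup] D_in_Bij unfolding Dpow_def carrier_BijGroup .
  also have "\<dots> = inv_into UNIV D"
    using inv_BijGroup[OF D_in_Bij] by (simp add: Dpow_1 restrict_UNIV)
  finally show ?thesis using Dpow_add[of "-1" k] by simp
qed

lemma linear_Dpow: "linear (Dpow k)"
proof (induction k rule: int_induct[where k = 0])
  case base
  then show ?case by (simp add: Dpow_0 linear_id[unfolded id_def])
next
  case (step1 i)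
  show ?case unfolding Dpow_succ by (rule linear_compose[OF step1(2) linear_gen0])
next
  case (step2 i)
  show ?case
    unfolding Dpow_pred by (rule linear_compose[OF step2(2) inj_linear_imp_inv_linear[OF linear_gen0 inj_D]])
qed

lemma fst_Dpow: "fst (Dpow k p) = of_real (\<alpha> powi k) * fst p"
proof (induction k rule: int_induct[where k = 0])
  case base
  then show ?case by (simp add: Dpow_0)
next
  case (step1 i)
  then show ?case
    using alpha_pos by (simp add: Dpow_succ gen0_apply power_int_add)
next
  case (step2 i)
  have "fst (D (inv_into UNIV D q)) = fst q" for q
    using bij_D by (simp add: bij_is_surj surj_f_inv_f)
  then have "fst (inv_into UNIV D q) = fst q / of_real \<alpha>" for q
    using alpha_pos by (simp add: gen0_apply field_simps)
  then show ?case
    using step2 alpha_pos by (simp add: Dpow_pred power_int_diff)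
qed

lemma Im_fst_Dpow: "Im (fst (Dpow k p)) = \<alpha> powi k * Im (fst p)"
  by (simp add: fst_Dpow del: of_real_power_int)

lemma D_uvec_comb: "D (uvec_comb x) = uvec_comb (transpose (rmat M) *v x)"
proof -
  have a: "real_pairing x (cmat M *v vec_of_real a) = of_real \<alpha> * real_pairing x (vec_of_real a)"
    by (simp add: cmat_mult_vec_of_real a_eig real_pairing_vec_of_real sum_distrib_left mult_ac)
  have b: "real_pairing x (cmat M *v b j) = (\<Sum>l\<in>UNIV. R $ l $ j * real_pairing x (b l))" for j
    using R_def by simp
  have "D (uvec_comb x)
      = (of_real \<alpha> * real_pairing x (vec_of_real a), transpose R *v (\<chi> j. real_pairing x (b j)))"
    by (simp add: uvec_comb_eq gen0_apply)
  also have "\<dots> = (real_pairing x (cmat M *v vec_of_real a), \<chi> j. real_pairing x (cmat M *v b j))"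
    by (simp add: a b vec_eq_iff vector_matrix_mult_def mult.commute)
  also have "\<dots> = uvec_comb (transpose (rmat M) *v x)"
    by (simp only: uvec_comb_eq real_pairing_transpose_rmat)
  finally show ?thesis .
qed

definition u_lattice :: "(complex \<times> (complex^'n)) set" where
  "u_lattice = uvec_comb ` int_vecs"

lemma int_entries_transpose_rmat: "transpose (rmat M) $ i $ j \<in> \<int>"
  by (simp add: transpose_def rmat_def)

lemma D_u_lattice: "v \<in> u_lattice \<Longrightarrow> D v \<in> u_lattice"
  unfolding u_lattice_def
  using D_uvec_comb int_vecs_matrix_vector_mult[OF int_entries_transpose_rmat] by auto

lemma inv_D_u_lattice:
  assumes "v \<in> u_lattice"
  shows "inv_into UNIV D v \<in> u_lattice"
proof -
  obtain y where y: "y \<in> int_vecs" "v = uvec_comb y" using assms by (auto simp: u_lattice_def)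
  have "det (transpose (rmat M)) = 1"
    using det_map_of_int[of M, where 'a = real] SL by (simp add: rmat_def)
  then obtain x where x: "x \<in> int_vecs" "transpose (rmat M) *v x = y"
    using unimodular_int_vecs_preimage[OF int_entries_transpose_rmat _ y(1)] by blast
  then have "inv_into UNIV D v = uvec_comb x"
    using y(2) x(2) D_uvec_comb[of x] inj_D by (metis inv_f_f)
  then show ?thesis using x(1) by (simp add: u_lattice_def)
qed

lemma Dpow_u_lattice: "v \<in> u_lattice \<Longrightarrow> Dpow k v \<in> u_lattice"
proof (induction k arbitrary: v rule: int_induct[where k = 0])
  case base
  then show ?case by (simp add: Dpow_0)
next
  case (step1 i)
  then show ?case by (simp add: Dpow_succ D_u_lattice)
next
  case (step2 i)
  then show ?case by (simp add: Dpow_pred inv_D_u_lattice)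
qed

lemma zero_in_u_lattice: "0 \<in> u_lattice"
  unfolding u_lattice_def
  by (rule image_eqI[of _ _ 0]) (simp_all add: linear_0[OF linear_uvec_comb] int_vecs_def)

lemma u_lattice_add:
  assumes "v \<in> u_lattice" "w \<in> u_lattice"
  shows "v + w \<in> u_lattice"
proof -
  obtain x y where "x \<in> int_vecs" "y \<in> int_vecs" "v = uvec_comb x" "w = uvec_comb y"
    using assms by (auto simp: u_lattice_def)
  then have "v + w = uvec_comb (x + y)" "x + y \<in> int_vecs"
    using linear_add[OF linear_uvec_comb] int_vecs_add by simp_all
  then show ?thesis by (simp add: u_lattice_def)
qed

lemma u_lattice_uminus:
  assumes "v \<in> u_lattice"
  shows "- v \<in> u_lattice"
proof -
  obtain x where "x \<in> int_vecs" "v = uvec_comb x"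
    using assms by (auto simp: u_lattice_def)
  then have "- v = uvec_comb (- x)" "- x \<in> int_vecs"
    using linear_neg[OF linear_uvec_comb] int_vecs_uminus by simp_all
  then show ?thesis by (simp add: u_lattice_def)
qed

lemma uvec_in_u_lattice: "uvec a b i \<in> u_lattice"
proof -
  have "uvec_comb (axis i 1) = uvec a b i"
    by (simp add: uvec_comb_def axis_def if_distrib[of "\<lambda>r. r *\<^sub>R _"] cong: if_cong)
  then show ?thesis unfolding u_lattice_def by (rule image_eqI[OF sym int_vecs_axis])
qed

lemma Im_fst_u_lattice: "v \<in> u_lattice \<Longrightarrow> Im (fst v) = 0"
  by (auto simp: u_lattice_def uvec_comb_eq real_pairing_vec_of_real)

lemma finite_u_lattice_Int_bounded: "bounded S \<Longrightarrow> finite (u_lattice \<inter> S)"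
  unfolding u_lattice_def
  by (rule finite_linear_image_int_vecs_Int_bounded[OF linear_uvec_comb inj_uvec_comb])

section \<open>The action of \<open>G\<^sub>M\<close>\<close>

definition affine_map :: "int \<Rightarrow> complex \<times> (complex^'n) \<Rightarrow> complex \<times> (complex^'n) \<Rightarrow> complex \<times> (complex^'n)" where
  "affine_map k v = (\<lambda>p\<in>HC. Dpow k p + v)"

lemma Dpow_plus_in_HC: "p \<in> HC \<Longrightarrow> v \<in> u_lattice \<Longrightarrow> Dpow k p + v \<in> HC"
  using alpha_pos by (simp add: mem_HC_iff Im_fst_Dpow Im_fst_u_lattice)

lemma Dpow_minus_cancel: "Dpow (- k) (Dpow k p) = p" "Dpow k (Dpow (- k) p) = p"
proof -
  have "Dpow (- k) \<circ> Dpow k = id" "Dpow k \<circ> Dpow (- k) = id"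
    using Dpow_add[of "- k" k] Dpow_add[of k "- k"] by (simp_all add: Dpow_0)
  then show "Dpow (- k) (Dpow k p) = p" "Dpow k (Dpow (- k) p) = p"
    by (simp_all add: pointfree_idE)
qed

lemma affine_map_in_Bij:
  assumes "v \<in> u_lattice"
  shows "affine_map k v \<in> Bij HC"
proof -
  define v' where "v' = - Dpow (- k) v"
  have v': "v' \<in> u_lattice" using assms by (simp add: v'_def u_lattice_uminus Dpow_u_lattice)
  let ?f = "\<lambda>p. Dpow k p + v" and ?g = "\<lambda>p. Dpow (- k) p + v'"
  have g: "?g p = Dpow (- k) (p - v)" for p
    using linear_diff[OF linear_Dpow] by (simp add: v'_def)
  have "bij_betw ?f HC HC"
  proof (rule bij_betw_byWitness[where f' = ?g])
    show "\<forall>p\<in>HC. ?g (?f p) = p" "\<forall>p\<in>HC. ?f (?g p) = p"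
      unfolding g by (simp_all add: Dpow_minus_cancel)
    show "?f ` HC \<subseteq> HC" "?g ` HC \<subseteq> HC"
      using Dpow_plus_in_HC assms v' by blast+
  qed
  moreover have "bij_betw (affine_map k v) HC HC \<longleftrightarrow> bij_betw ?f HC HC"
    unfolding affine_map_def by (rule bij_betw_cong) simp
  ultimately show ?thesis by (simp add: Bij_def affine_map_def)
qed

lemma affine_map_mult:
  assumes "v \<in> u_lattice" "w \<in> u_lattice"
  shows "affine_map k v \<otimes>\<^bsub>BijGroup HC\<^esub> affine_map l w = affine_map (k + l) (Dpow k w + v)"
proof -
  have eq: "Dpow k (Dpow l p + w) + v = Dpow (k + l) p + (Dpow k w + v)" for p
    using linear_add[OF linear_Dpow] by (simp add: Dpow_add add.assoc)
  show ?thesis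
    unfolding mult_BijGroup[OF affine_map_in_Bij[OF assms(1)] affine_map_in_Bij[OF assms(2)]]
    by (rule ext) (simp add: compose_def affine_map_def Dpow_plus_in_HC[OF _ assms(2)] eq)
qed

lemma affine_map_one: "\<one>\<^bsub>BijGroup HC\<^esub> = affine_map 0 0"
  by (simp add: BijGroup_def affine_map_def Dpow_0)

lemma affine_map_inv:
  assumes "v \<in> u_lattice"
  shows "inv\<^bsub>BijGroup HC\<^esub> (affine_map k v) = affine_map (- k) (- Dpow (- k) v)"
proof (rule group.inv_equality[OF group_BijGroup])
  have w: "- Dpow (- k) v \<in> u_lattice" using assms by (intro u_lattice_uminus Dpow_u_lattice)
  show "affine_map (- k) (- Dpow (- k) v) \<otimes>\<^bsub>BijGroup HC\<^esub> affine_map k v = \<one>\<^bsub>BijGroup HC\<^esub>"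
    using affine_map_mult[OF w assms] by (simp add: affine_map_one)
  show "affine_map k v \<in> carrier (BijGroup HC)" "affine_map (- k) (- Dpow (- k) v) \<in> carrier (BijGroup HC)"
    using affine_map_in_Bij assms w by (simp_all add: BijGroup_def)
qed

lemma subgroup_affine_maps: "subgroup {affine_map k v | k v. v \<in> u_lattice} (BijGroup HC)"
proof
  show "{affine_map k v | k v. v \<in> u_lattice} \<subseteq> carrier (BijGroup HC)"
    using affine_map_in_Bij by (auto simp: carrier_BijGroup)
  show "\<one>\<^bsub>BijGroup HC\<^esub> \<in> {affine_map k v | k v. v \<in> u_lattice}"
    unfolding affine_map_one using zero_in_u_lattice by blast
next
  fix g h assume "g \<in> {affine_map k v | k v. v \<in> u_lattice}" "h \<in> {affine_map k v | k v. v \<in> u_lattice}"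
  then obtain k v l w where "v \<in> u_lattice" "w \<in> u_lattice" "g = affine_map k v" "h = affine_map l w"
    by blast
  then have "g \<otimes>\<^bsub>BijGroup HC\<^esub> h = affine_map (k + l) (Dpow k w + v)" "Dpow k w + v \<in> u_lattice"
    by (simp_all add: affine_map_mult Dpow_u_lattice u_lattice_add)
  then show "g \<otimes>\<^bsub>BijGroup HC\<^esub> h \<in> {affine_map k v | k v. v \<in> u_lattice}" by blast
next
  fix g assume "g \<in> {affine_map k v | k v. v \<in> u_lattice}"
  then obtain k v where "v \<in> u_lattice" "g = affine_map k v" by blast
  then have "inv\<^bsub>BijGroup HC\<^esub> g = affine_map (- k) (- Dpow (- k) v)" "- Dpow (- k) v \<in> u_lattice"
    by (simp_all add: affine_map_inv Dpow_u_lattice u_lattice_uminus)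
  then show "inv\<^bsub>BijGroup HC\<^esub> g \<in> {affine_map k v | k v. v \<in> u_lattice}" by blast
qed

lemma GM_subset_affine_maps: "GM \<alpha> R a b \<subseteq> {affine_map k v | k v. v \<in> u_lattice}"
  unfolding GM_def
proof (rule group.generate_subgroup_incl[OF group_BijGroup _ subgroup_affine_maps])
  have "restrict D HC = affine_map 1 0"
    using Dpow_succ[of 0] by (simp add: affine_map_def Dpow_0)
  moreover have "restrict (gentr a b i) HC = affine_map 0 (uvec a b i)" for i
    by (simp add: affine_map_def gentr_def Dpow_0)
  ultimately show "insert (restrict D HC) (range (\<lambda>i. restrict (gentr a b i) HC))
      \<subseteq> {affine_map k v | k v. v \<in> u_lattice}"
    using zero_in_u_lattice uvec_in_u_lattice by blast
qed

theorem free_action_GM: "free_action HC (GM \<alpha> R a b)"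
  unfolding free_action_def
proof (intro ballI impI)
  fix g p assume g: "g \<in> GM \<alpha> R a b" and p: "p \<in> HC" and fixed: "g p = p"
  obtain k v where v: "v \<in> u_lattice" and g_eq: "g = affine_map k v"
    using GM_subset_affine_maps g by blast
  have p_eq: "Dpow k p + v = p" using fixed p by (simp add: g_eq affine_map_def)
  then have "Im (fst (Dpow k p + v)) = Im (fst p)" by simp
  then have "\<alpha> powi k * Im (fst p) = Im (fst p)"
    using Im_fst_u_lattice[OF v] by (simp add: Im_fst_Dpow)
  then have "k = 0"
    using p powi_eq_1_iff[OF alpha_pos alpha_ne1] by (simp add: mem_HC_iff)
  then have "v = 0" using p_eq by (simp add: Dpow_0)
  then show "g = (\<lambda>x\<in>HC. x)" using \<open>k = 0\<close> by (simp add: g_eq affine_map_def Dpow_0)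
qed

lemma compact_Dpow_difference_image:
  assumes "compact K"
  shows "compact ((\<lambda>(q, p). q - Dpow k p) ` (K \<times> K))"
proof (rule compact_continuous_image[OF _ compact_Times[OF assms assms]])
  have "continuous_on UNIV (Dpow k)"
    using linear_Dpow[of k] by (simp add: linear_continuous_on linear_conv_bounded_linear)
  then have "continuous_on (K \<times> K) (\<lambda>x. Dpow k (snd x))"
    by (rule continuous_on_compose2[OF _ continuous_on_snd[OF continuous_on_id] subset_UNIV])
  then show "continuous_on (K \<times> K) (\<lambda>(q, p). q - Dpow k p)"
    unfolding case_prod_unfold by (rule continuous_on_diff[OF continuous_on_fst[OF continuous_on_id]])
qed

theorem properly_discontinuous_GM: "properly_discontinuous HC (GM \<alpha> R a b)"
  unfolding properly_discontinuous_def
proof (intro allI impI)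
  fix K :: "(complex \<times> (complex^'n)) set"
  assume "compact K \<and> K \<subseteq> HC"
  then have K: "compact K" "K \<subseteq> HC" by auto
  then obtain c C where c: "0 < c" and Im_K: "\<forall>p\<in>K. Im (fst p) \<in> {c..C}"
    by (rule compact_subset_HC_Im_bounds)
  define E where "E = {k::int. \<exists>s\<in>{c..C}. \<alpha> powi k * s \<in> {c..C}}"
  define S where "S = (\<Union>k\<in>E. (\<lambda>(q, p). q - Dpow k p) ` (K \<times> K))"
  have "finite E"
    unfolding E_def using c alpha_pos alpha_ne1 by (rule finite_powi_exponents_between)
  then have "compact S"
    unfolding S_def using K(1) by (simp add: compact_UN compact_Dpow_difference_image)
  have "{g \<in> GM \<alpha> R a b. g ` K \<inter> K \<noteq> {}} \<subseteq> (\<lambda>(k, v). affine_map k v) ` (E \<times> (u_lattice \<inter> S))"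
  proof
    fix g assume "g \<in> {g \<in> GM \<alpha> R a b. g ` K \<inter> K \<noteq> {}}"
    then obtain p where g: "g \<in> GM \<alpha> R a b" and p: "p \<in> K" "g p \<in> K" by blast
    obtain k v where v: "v \<in> u_lattice" and g_eq: "g = affine_map k v"
      using GM_subset_affine_maps g by blast
    define q where "q = Dpow k p + v"
    have q: "q \<in> K" using p K(2) by (auto simp: q_def g_eq affine_map_def)
    have "Im (fst q) = \<alpha> powi k * Im (fst p)"
      using Im_fst_u_lattice[OF v] by (simp add: q_def Im_fst_Dpow)
    then have "Im (fst p) \<in> {c..C}" "\<alpha> powi k * Im (fst p) \<in> {c..C}"
      using Im_K p(1) q by auto
    then have k: "k \<in> E" unfolding E_def by blast
    have "v = (\<lambda>(q, p). q - Dpow k p) (q, p)" "(q, p) \<in> K \<times> K"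
      using p(1) q by (simp_all add: q_def)
    then have "v \<in> S" unfolding S_def using k by blast
    then have "(k, v) \<in> E \<times> (u_lattice \<inter> S)" using k v by blast
    then show "g \<in> (\<lambda>(k, v). affine_map k v) ` (E \<times> (u_lattice \<inter> S))"
      by (rule image_eqI[rotated]) (simp add: g_eq)
  qed
  moreover have "finite (u_lattice \<inter> S)"
    by (intro finite_u_lattice_Int_bounded compact_imp_bounded \<open>compact S\<close>)
  then have "finite ((\<lambda>(k, v). affine_map k v) ` (E \<times> (u_lattice \<inter> S)))"
    using \<open>finite E\<close> by simp
  ultimately show "finite {g \<in> GM \<alpha> R a b. g ` K \<inter> K \<noteq> {}}"
    by (rule finite_subset)
qed

end

theorem proposition2p7:
  fixes M :: "int^('m::finite)^'m" and \<alpha> :: real and a :: "real^'m"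
    and b :: "('n::finite) \<Rightarrow> complex^'m" and R :: "complex^'n^'n"
  assumes dim: "CARD('m) = 2 * CARD('n) + 1"
    and SL: "det M = 1"
    and unique_real: "\<forall>l. (mat_eigenvalue (cmat M) l \<and> Im l = 0) \<longleftrightarrow> l = complex_of_real \<alpha>"
    and alpha_pos: "\<alpha> > 0" and alpha_ne1: "\<alpha> \<noteq> 1"
    and simple: "Polynomial.order (complex_of_real \<alpha>) (charpoly (cmat M)) = 1"
    and a_nz: "a \<noteq> 0" and a_eig: "rmat M *v a = \<alpha> *s a"
    and b_inj: "inj b" and b_indep: "vec.independent (range b)"
    and b_span: "vec.span (range b) = upper_space (cmat M)"
    and R_def: "\<forall>j. cmat M *v b j = (\<Sum>l\<in>UNIV. R $ l $ j *s b l)"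
  shows "free_action HC (GM \<alpha> R a b) \<and> properly_discontinuous HC (GM \<alpha> R a b)"
proof -
  interpret GM_data M \<alpha> a b R
    by unfold_locales (fact dim SL alpha_pos alpha_ne1 a_nz a_eig b_inj b_indep b_span R_def)+
  show ?thesis using free_action_GM properly_discontinuous_GM by blast
qed

end
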